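(* For natural numbers $n\ge0$ and $n-s\ge0$, the single factorial function $(n-s)!$ satisfies the following congruences whenever $h\ge2$ is a fixed integer (or when $h$ corresponds to some fixed function with an implicit dependence on the sequence index $n$). First, $$(n-s)!\equiv C_{h,n-s}(1,1)\pmod h,$$ where $$C_{h,n-s}(1,1)=\sum_{i=0}^{n-s}\binom hi(-h)_i\,(n-s-i)!=\sum_{i=0}^{n-s}\binom hi^2(-1)^i\,i!\,(n-s-i)!=\sum_{i=0}^{n-s}\binom hi\binom{i-h-1}{i}\,i!\,(n-s-i)!.$$ Second, $$(n-s)!\equiv C_{h,n-s}(-1,n-s)\pmod h,$$ where $$C_{h,n-s}(-1,n-s)=\sum_{i=0}^{n-s}\binom hi(n+1-s-h)_i\,(-1)^{n-s-i}\bigl(-(n-s)\bigr)_{n-s-i}=\sum_{i=0}^{n-s}\binom hi\binom{n-s}{i}\binom{h-n+s-1}{i}(-1)^i\,i!\,(n-s-i)!.$$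
   Context: The symbol $(x)_m=x(x+1)\cdots(x+m-1)$ is the Pochhammer symbol (rising factorial), with $(x)_0=1$, and $\binom{x}{i}=x(x-1)\cdots(x-i+1)/i!$ for any integer $x$ (possibly negative) and $i\ge0$. The generalized factorial product is $p_m(\alpha,R)=R(R+\alpha)\cdots(R+(m-1)\alpha)$ for $m\ge1$, with $p_0(\alpha,R)=1$. The terms $C_{h,m}(\alpha,R)$ are the auxiliary convergent function sequences: $C_{h,m}(\alpha,R)=[z^m]\,\mathrm{FP}_h(\alpha,R;z)$ for $0\le m<h$, the coefficients of the numerator polynomial $\mathrm{FP}_h(\alpha,R;z)$ of the $h$-th convergent to the infinite J-fraction expansion of $\sum_{n\ge0}p_n(\alpha,R)z^n$. This polynomial is $$\mathrm{FP}_h(\alpha,R;z)=\sum_{m=0}^{h-1}C_{h,m}(\alpha,R)z^m=\sum_{m=0}^{h-1}\left(\sum_{i=0}^m\binom hi(-1)^i\,p_i\bigl(-\alpha,R+(h-1)\alpha\bigr)\,p_{m-i}(\alpha,R)\right)z^m=\sum_{m=0}^{h-1}\left(\sum_{i=0}^m\binom hi\left(1-h-\frac R\alpha\right)_i\left(\frac R\alpha\right)_{m-i}\right)(\alpha z)^m.$$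
   Formalization: In the second part, the sums equal to C_{h,n-s}(-1,n-s) carry sign (-1)^{n-s} instead of (-1)^{n-s-i}, and no (-1)^i in the last; the printed sums are only congruent to it mod h (h=3, n-s=1: 4 vs -2). For n-s≥h, C is the closed sum. *)

theory Defs
  imports
    "HOL-Computational_Algebra.Computational_Algebra"
    "HOL-Number_Theory.Cong"
begin

definition gen_fact_prod :: "nat \<Rightarrow> 'a::comm_ring_1 \<Rightarrow> 'a \<Rightarrow> 'a" where
  "gen_fact_prod m \<alpha> R = (\<Prod>j<m. R + of_nat j * \<alpha>)"

text \<open>
  Numerators and denominators of the convergents to the J-fraction
  1 / (1 - c 1 z - b 2 z^2 / (1 - c 2 z - b 3 z^2 / (1 - c 3 z - ...))),
  by the fundamental recurrences. The h-th convergent is the fraction cut off after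
  the partial denominator 1 - c h z, so the 0-th one is 0 / 1.
\<close>

fun jfrac_num :: "(nat \<Rightarrow> 'a::comm_ring_1) \<Rightarrow> (nat \<Rightarrow> 'a) \<Rightarrow> nat \<Rightarrow> 'a poly" where
  "jfrac_num c b 0 = 0"
| "jfrac_num c b (Suc 0) = 1"
| "jfrac_num c b (Suc (Suc h)) =
     [:1, - c (h + 2):] * jfrac_num c b (Suc h) - monom (b (h + 2)) 2 * jfrac_num c b h"

fun jfrac_denom :: "(nat \<Rightarrow> 'a::comm_ring_1) \<Rightarrow> (nat \<Rightarrow> 'a) \<Rightarrow> nat \<Rightarrow> 'a poly" where
  "jfrac_denom c b 0 = 1"
| "jfrac_denom c b (Suc 0) = [:1, - c 1:]"
| "jfrac_denom c b (Suc (Suc h)) =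
     [:1, - c (h + 2):] * jfrac_denom c b (Suc h) - monom (b (h + 2)) 2 * jfrac_denom c b h"

text \<open>
  The coefficients of the J-fraction that expands the generating function of
  \<open>gen_fact_prod n \<alpha> R\<close>; this is what \<open>FP_FQ_expansion\<close> below proves.
\<close>

definition jfrac_c :: "'a::comm_ring_1 \<Rightarrow> 'a \<Rightarrow> nat \<Rightarrow> 'a" where
  "jfrac_c \<alpha> R h = R + 2 * \<alpha> * (of_nat h - 1)"

definition jfrac_ab :: "'a::comm_ring_1 \<Rightarrow> 'a \<Rightarrow> nat \<Rightarrow> 'a" where
  "jfrac_ab \<alpha> R h = \<alpha> * (R + (of_nat h - 2) * \<alpha>) * (of_nat h - 1)"

definition FP :: "nat \<Rightarrow> 'a::comm_ring_1 \<Rightarrow> 'a \<Rightarrow> 'a poly" where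
  "FP h \<alpha> R = jfrac_num (jfrac_c \<alpha> R) (jfrac_ab \<alpha> R) h"

definition FQ :: "nat \<Rightarrow> 'a::comm_ring_1 \<Rightarrow> 'a \<Rightarrow> 'a poly" where
  "FQ h \<alpha> R = jfrac_denom (jfrac_c \<alpha> R) (jfrac_ab \<alpha> R) h"

text \<open>
  \<open>C_seq h m \<alpha> R\<close> is the coefficient of z^m in \<open>FP h \<alpha> R\<close>, which has degree below h. For indices
  m outside the range m < h it is the formal continuation of the closed formula for those
  coefficients (and not 0).
\<close>

definition C_seq :: "nat \<Rightarrow> nat \<Rightarrow> 'a::comm_ring_1 \<Rightarrow> 'a \<Rightarrow> 'a" where
  "C_seq h m \<alpha> R =
     (if m < h then coeff (FP h \<alpha> R) m
      else \<Sum>i\<le>m. of_nat (h choose i) * (-1) ^ i *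
             gen_fact_prod i (- \<alpha>) (R + (of_nat h - 1) * \<alpha>) * gen_fact_prod (m - i) \<alpha> R)"

definition FP_FQ_remainder :: "nat \<Rightarrow> 'a::comm_ring_1 \<Rightarrow> 'a \<Rightarrow> 'a fps" where
  "FP_FQ_remainder h \<alpha> R = Abs_fps (\<lambda>m. if m < h then 0 else
     \<alpha> ^ h * (\<Prod>j<h. of_nat (m - h) - of_nat j) * gen_fact_prod (m - h) \<alpha> R)"

lemma FP_FQ_remainder_step:
  "FP_FQ_remainder (Suc (Suc h)) \<alpha> R =
     fps_of_poly [:1, - jfrac_c \<alpha> R (h + 2):] * FP_FQ_remainder (Suc h) \<alpha> R
     - fps_of_poly (monom (jfrac_ab \<alpha> R (h + 2)) 2) * FP_FQ_remainder h \<alpha> R"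
proof (rule fps_ext)
  fix m
  define c where "c = jfrac_c \<alpha> R (h + 2)"
  define b where "b = jfrac_ab \<alpha> R (h + 2)"
  let ?D = "\<lambda>h. FP_FQ_remainder h \<alpha> R"
  have 1: "fps_of_poly [:1, - c:] * F = F - fps_const c * (fps_X * F)" for F :: "'a fps"
    by (simp add: fps_of_poly_pCons algebra_simps flip: fps_const_neg)
  have 2: "fps_of_poly (monom b 2) * F = fps_const b * (fps_X ^ 2 * F)" for F :: "'a fps"
    by (simp add: fps_of_poly_monom mult.assoc)
  have rhs: "(fps_of_poly [:1, - c:] * ?D (Suc h) - fps_of_poly (monom b 2) * ?D h) $ m =
      ?D (Suc h) $ m - c * (if m = 0 then 0 else ?D (Suc h) $ (m - 1))
      - b * (if m < 2 then 0 else ?D h $ (m - 2))"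
    unfolding 1 2 by (simp add: fps_X_power_mult_nth)
  have "?D (Suc (Suc h)) $ m = \<dots>"
  proof (cases "m < Suc (Suc h)")
    case True
    then consider "m < Suc h" | "m = Suc h" by linarith
    then show ?thesis
    proof cases
      case 1
      then show ?thesis using True by (auto simp: FP_FQ_remainder_def)
    next
      case 2
      then show ?thesis by (auto simp: FP_FQ_remainder_def lessThan_Suc_eq_insert_0 prod_zero_iff)
    qed
  next
    case False
    define k where "k = m - Suc (Suc h)"
    have m: "m = k + Suc (Suc h)" using False k_def by simp
    define X where "X = (\<Prod>j<h. of_nat k - of_nat j :: 'a)"
    define x where "x = (of_nat k :: 'a)"
    define y where "y = (of_nat h :: 'a)"
    define q where "q = gen_fact_prod k \<alpha> R"
    have q: "gen_fact_prod (Suc k) \<alpha> R = q * (R + x * \<alpha>)"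
      by (simp add: q_def x_def gen_fact_prod_def)
    have X1: "(\<Prod>j<Suc h. of_nat (Suc k) - of_nat j :: 'a) = (x + 1) * X"
      by (subst prod.lessThan_Suc_shift) (simp add: X_def x_def add.commute)
    have X2: "(\<Prod>j<Suc h. of_nat k - of_nat j :: 'a) = X * (x - y)"
      by (simp add: X_def x_def y_def)
    have X3: "(\<Prod>j<Suc (Suc h). of_nat k - of_nat j :: 'a) = X * (x - y) * (x - y - 1)"
      by (simp add: X_def x_def y_def algebra_simps)
    have D: "?D (Suc (Suc h)) $ m = \<alpha> ^ Suc (Suc h) * (X * (x - y) * (x - y - 1)) * q"
        "?D (Suc h) $ m = \<alpha> ^ Suc h * ((x + 1) * X) * (q * (R + x * \<alpha>))"
        "?D (Suc h) $ (m - 1) = \<alpha> ^ Suc h * (X * (x - y)) * q"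
        "?D h $ (m - 2) = \<alpha> ^ h * X * q"
      unfolding X3[symmetric] X1[symmetric] q[symmetric]
      by (simp_all add: FP_FQ_remainder_def m q_def X_def Suc_diff_le X2[unfolded X_def]
        del: prod.lessThan_Suc power_Suc)
    have cb: "c = R + 2 * \<alpha> * (y + 1)" "b = \<alpha> * (R + y * \<alpha>) * (y + 1)"
      by (simp_all add: c_def b_def jfrac_c_def jfrac_ab_def y_def algebra_simps)
    have "\<alpha> ^ Suc (Suc h) * (X * (x - y) * (x - y - 1)) * q =
        \<alpha> ^ Suc h * ((x + 1) * X) * (q * (R + x * \<alpha>)) - c * (\<alpha> ^ Suc h * (X * (x - y)) * q)
        - b * (\<alpha> ^ h * X * q)"
      unfolding cb power_Suc by (simp add: algebra_simps)
    moreover have "m \<noteq> 0" "\<not> m < 2" using m by simp_all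
    ultimately show ?thesis by (simp only: D if_False)
  qed
  then show "?D (Suc (Suc h)) $ m =
      (fps_of_poly [:1, - jfrac_c \<alpha> R (h + 2):] * ?D (Suc h)
       - fps_of_poly (monom (jfrac_ab \<alpha> R (h + 2)) 2) * ?D h) $ m"
    using rhs by (simp add: c_def b_def)
qed

lemma FP_FQ_remainder_eq:
  "fps_of_poly (FQ h \<alpha> R) * Abs_fps (\<lambda>n. gen_fact_prod n \<alpha> R) - fps_of_poly (FP h \<alpha> R)
     = FP_FQ_remainder h \<alpha> R"
  (is "_ * ?S - _ = _")
proof (induction h rule: induct_nat_012)
  case 0
  show ?case by (simp add: FP_def FQ_def FP_FQ_remainder_def fps_eq_iff)
next
  case 1
  show ?case
  proof (rule fps_ext)
    fix m
    show "(fps_of_poly (FQ (Suc 0) \<alpha> R) * ?S - fps_of_poly (FP (Suc 0) \<alpha> R)) $ m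
        = FP_FQ_remainder (Suc 0) \<alpha> R $ m"
      by (cases m) (simp_all add: FP_def FQ_def FP_FQ_remainder_def jfrac_c_def gen_fact_prod_def
        fps_of_poly_pCons algebra_simps flip: fps_const_neg)
  qed
next
  case (ge2 h)
  show ?case
    unfolding FP_FQ_remainder_step ge2(1)[symmetric] ge2(2)[symmetric]
    unfolding FP_def FQ_def jfrac_num.simps jfrac_denom.simps fps_of_poly_diff fps_of_poly_mult
    by (simp only: algebra_simps diff_diff_eq2)
qed

theorem FP_FQ_expansion:
  assumes "n < 2 * h"
  shows "(fps_of_poly (FQ h \<alpha> R) * Abs_fps (\<lambda>n. gen_fact_prod n \<alpha> R)) $ n = coeff (FP h \<alpha> R) n"
proof -
  have "FP_FQ_remainder h \<alpha> R $ n = 0"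
  proof (cases "n < h")
    case False
    then have "n - h \<in> {..<h}" using assms by auto
    then have "(\<Prod>j<h. of_nat (n - h) - of_nat j :: 'a) = 0"
      by (subst prod.remove[of _ "n - h"]) auto
    then show ?thesis by (simp add: FP_FQ_remainder_def del: of_nat_diff)
  qed (simp add: FP_FQ_remainder_def)
  then show ?thesis by (simp flip: FP_FQ_remainder_eq)
qed

end

theory Submission
  imports Defs
begin

text \<open>
  Why the theorem holds. The coefficients of the convergent's denominator \<open>FQ\<close> have a closed
  product form (\<open>coeff_FQ\<close>), because that form satisfies the three-term recurrence. The numerator
  \<open>FP\<close> agrees with the product of \<open>FQ\<close> and the generating function of \<open>gen_fact_prod\<close> at least up
  to the order \<open>h\<close>, so a Cauchy product gives \<open>C_seq\<close> as a single sum (\<open>C_seq_eq_sum\<close>). At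
  \<open>\<alpha> = 1\<close> and \<open>\<alpha> = - 1\<close> its factors are ordinary Pochhammer symbols, and the
  other sums equal to \<open>C_seq\<close> arise from this one term by term, by rewriting Pochhammer symbols as
  binomial coefficients.

  For the congruences, the term with index 0 is \<open>m!\<close>, and all others are divisible by \<open>h\<close>. In the
  first case \<open>pochhammer (- h) i\<close> has the factor \<open>- h\<close> as soon as \<open>i > 0\<close>. In the second case
  the \<open>i\<close>-th term contains \<open>h choose i\<close> times a product of \<open>i\<close> consecutive integers. The latter
  is a multiple of \<open>i!\<close> (\<open>fact_dvd_pochhammer_int\<close>), and
  \<open>(h choose i) * i! = h * (h - 1) * \<dots> * (h - i + 1)\<close> is a multiple of \<open>h\<close>
  (\<open>dvd_binomial_times_fact\<close>). This divisibility holds for each term separately, so the sum with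
  the sign \<open>(-1) ^ (m - i)\<close> in place of \<open>(-1) ^ m\<close> has the same residue, although its value is in
  general a different one.
\<close>

section \<open>The denominators of the convergents\<close>

text \<open>
  The form that absorption takes in a ring without division: it is the one relation between the
  binomial coefficients, besides Pascal's rule, that the recurrence for \<open>FQ\<close> calls for.
\<close>

lemma binomial_shift_ring:
  "(of_nat h + 1) * of_nat (h choose (k + 2)) =
     (of_nat h - 1 - of_nat k) * (of_nat (Suc h choose (k + 2)) :: 'a::comm_ring_1)"
proof (cases "k + 1 \<le> h")
  case True
  then obtain d where d: "h = k + 1 + d" using le_Suc_ex by blast
  have "d * (Suc h choose (k + 2)) = Suc h * (h choose (k + 2))"
    using binomial_absorb_comp[of "Suc h" "k + 2"] by (simp add: d)
  from arg_cong[OF this, of "of_nat :: nat \<Rightarrow> 'a"]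
  have "of_nat d * of_nat (Suc h choose (k + 2)) =
      (of_nat h + 1) * (of_nat (h choose (k + 2)) :: 'a)"
    by (simp only: of_nat_mult of_nat_Suc add.commute)
  moreover have "of_nat d = (of_nat h - 1 - of_nat k :: 'a)" by (simp add: d)
  ultimately show ?thesis by simp
next
  case False
  then show ?thesis by (simp add: binomial_eq_0)
qed

text \<open>
  Both sides satisfy the recurrence of the denominators. At index \<open>k + 2\<close> all four terms of
  it are multiples of \<open>(R + h * \<alpha>) * X\<close>, where \<open>X\<close> is the product of length \<open>k\<close> at level \<open>h\<close>.
  Once this is split off, an identity remains that is linear in \<open>R\<close> and \<open>\<alpha>\<close>: its \<open>R\<close>-part is
  Pascal's rule, and its \<open>\<alpha>\<close>-part is \<open>binomial_shift_ring\<close>.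
\<close>

theorem coeff_FQ:
  "coeff (FQ h \<alpha> R) i =
     of_nat (h choose i) * (-1) ^ i * gen_fact_prod i (- \<alpha>) (R + (of_nat h - 1) * \<alpha>)"
proof (induction h arbitrary: i rule: induct_nat_012)
  case 0
  show ?case by (cases i) (simp_all add: FQ_def gen_fact_prod_def)
next
  case 1
  show ?case
    by (cases i; cases "i - 1")
      (simp_all add: FQ_def gen_fact_prod_def jfrac_c_def)
next
  case (ge2 h)
  define c where "c = jfrac_c \<alpha> R (h + 2)"
  define b where "b = jfrac_ab \<alpha> R (h + 2)"
  have cb: "c = R + 2 * \<alpha> * (of_nat h + 1)" "b = \<alpha> * (R + of_nat h * \<alpha>) * (of_nat h + 1)"
    by (simp_all add: c_def b_def jfrac_c_def jfrac_ab_def algebra_simps)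
  have step: "coeff (FQ (Suc (Suc h)) \<alpha> R) i =
      coeff (FQ (Suc h) \<alpha> R) i - (if i = 0 then 0 else c * coeff (FQ (Suc h) \<alpha> R) (i - 1))
      - (if i < 2 then 0 else b * coeff (FQ h \<alpha> R) (i - 2))"
    by (cases i) (simp_all add: FQ_def c_def b_def coeff_monom_mult)
  consider "i = 0" | "i = 1" | k where "i = k + 2"
    by (metis One_nat_def add_2_eq_Suc' not0_implies_Suc)
  then show ?case
  proof cases
    case 1
    then show ?thesis unfolding step ge2 by (simp add: gen_fact_prod_def)
  next
    case 2
    then show ?thesis unfolding step ge2 by (simp add: gen_fact_prod_def cb algebra_simps)
  next
    case (3 k)
    define x where "x = (of_nat h :: 'a)"
    define y where "y = (of_nat k :: 'a)"
    define X where "X = gen_fact_prod k (- \<alpha>) (R + (x - 1) * \<alpha>)"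
    define A where "A = (of_nat (h choose k) :: 'a)"
    define B where "B = (of_nat (h choose (k + 1)) :: 'a)"
    define D where "D = (of_nat (h choose (k + 2)) :: 'a)"
    \<comment> \<open>Raising the level by one raises the largest factor by \<open>\<alpha>\<close>, so a product at the next level
      is the old one with a new factor in front.\<close>
    have shift: "gen_fact_prod (Suc l) (- \<alpha>) (S + \<alpha>) = (S + \<alpha>) * gen_fact_prod l (- \<alpha>) S"
      for l S unfolding gen_fact_prod_def
      by (subst prod.lessThan_Suc_shift) (simp add: algebra_simps)
    have p1: "gen_fact_prod (k + 1) (- \<alpha>) (R + x * \<alpha>) = (R + x * \<alpha>) * X"
      using shift[of k "R + (x - 1) * \<alpha>"] by (simp add: X_def algebra_simps)
    have p2: "gen_fact_prod (k + 2) (- \<alpha>) (R + x * \<alpha>) =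
        (R + x * \<alpha>) * X * (R + (x - 1 - y) * \<alpha>)"
      using p1 by (simp add: gen_fact_prod_def y_def algebra_simps)
    have p3: "gen_fact_prod (k + 2) (- \<alpha>) (R + (x + 1) * \<alpha>) =
        (R + (x + 1) * \<alpha>) * ((R + x * \<alpha>) * X)"
      using shift[of "k + 1" "R + x * \<alpha>"] p1 by (simp add: algebra_simps)
    have bin: "(x + 1) * D = (x - 1 - y) * (B + D)"
      using binomial_shift_ring[of h k, where 'a = 'a]
      by (simp add: x_def y_def B_def D_def)
    have "(A + 2 * B + D) * (R + (x + 1) * \<alpha>) - (B + D) * (R + (x - 1 - y) * \<alpha>)
        - c * (A + B) + \<alpha> * (x + 1) * A = \<alpha> * ((x + 1) * D - (x - 1 - y) * (B + D))"
      unfolding cb x_def[symmetric] by (simp add: algebra_simps)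
    also have "\<dots> = 0" by (simp add: bin)
    finally have key: "(A + 2 * B + D) * (R + (x + 1) * \<alpha>) =
        (B + D) * (R + (x - 1 - y) * \<alpha>) + c * (A + B) - \<alpha> * (x + 1) * A"
      by (simp add: algebra_simps)
    have "(A + 2 * B + D) * (-1) ^ k * ((R + (x + 1) * \<alpha>) * ((R + x * \<alpha>) * X)) =
        ((A + 2 * B + D) * (R + (x + 1) * \<alpha>)) * ((-1) ^ k * ((R + x * \<alpha>) * X))"
      by (simp only: mult_ac)
    also have "\<dots> = (B + D) * (-1) ^ k * ((R + x * \<alpha>) * X * (R + (x - 1 - y) * \<alpha>))
        + c * ((A + B) * (-1) ^ k * ((R + x * \<alpha>) * X)) - b * (A * (-1) ^ k * X)"
      unfolding key cb(2) x_def[symmetric] by (simp add: algebra_simps)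
    finally have main: "(A + 2 * B + D) * (-1) ^ k * ((R + (x + 1) * \<alpha>) * ((R + x * \<alpha>) * X)) = \<dots>" .
    have *: "of_nat (Suc (Suc h) choose (k + 2)) = A + 2 * B + D"
      "of_nat (Suc h choose (k + 2)) = B + D" "of_nat (Suc h choose (k + 1)) = A + B"
      by (simp_all add: A_def B_def D_def)
    have hx: "of_nat (Suc (Suc h)) - 1 = x + 1" "of_nat (Suc h) - 1 = x"
      by (simp_all add: x_def)
    have i: "i \<noteq> 0" "\<not> i < 2" "i - 1 = k + 1" "i - 2 = k" "(-1) ^ i = ((-1) ^ k :: 'a)"
      "(-1) ^ (k + 1) = - ((-1) ^ k :: 'a)" using 3 by simp_all
    show ?thesis
      unfolding step ge2 if_not_P[OF i(1)] if_not_P[OF i(2)] i(3-6) hx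
      unfolding 3 * p1 p2 p3 main
      by (simp add: X_def A_def x_def)
  qed
qed

section \<open>The convergent function sequences as sums\<close>

theorem C_seq_eq_sum:
  "C_seq h m \<alpha> R =
     (\<Sum>i=0..m. of_nat (h choose i) * (-1) ^ i *
        gen_fact_prod i (- \<alpha>) (R + (of_nat h - 1) * \<alpha>) * gen_fact_prod (m - i) \<alpha> R)"
proof (cases "m < h")
  case True
  then have "coeff (FP h \<alpha> R) m =
      (fps_of_poly (FQ h \<alpha> R) * Abs_fps (\<lambda>n. gen_fact_prod n \<alpha> R)) $ m"
    by (subst FP_FQ_expansion) simp_all
  with True show ?thesis by (simp add: C_seq_def fps_mult_nth coeff_FQ)
next
  case False
  then show ?thesis by (simp add: C_seq_def atMost_atLeast0)
qed

lemma gen_fact_prod_1: "gen_fact_prod m 1 R = pochhammer R m"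
  by (simp add: gen_fact_prod_def pochhammer_prod lessThan_atLeast0)

lemma gen_fact_prod_minus_1: "gen_fact_prod m (- 1) R = (-1) ^ m * pochhammer (- R) m"
proof -
  have "(-1) ^ m * pochhammer (- R) m = (\<Prod>j<m. (-1) * (- R + of_nat j))"
    unfolding prod.distrib by (simp add: pochhammer_prod lessThan_atLeast0)
  then show ?thesis by (simp add: gen_fact_prod_def)
qed

section \<open>Rising factorials and divisibility\<close>

lemma pochhammer_uminus_gbinomial:
  fixes a :: "'a::field_char_0"
  shows "(-1) ^ k * pochhammer (- a) k = (a gchoose k) * fact k"
  by (simp add: gbinomial_pochhammer)

lemma pochhammer_uminus_of_nat:
  "(-1) ^ k * pochhammer (- int n) k = int (n choose k) * fact k"
proof -
  have "rat_of_int ((-1) ^ k * pochhammer (- int n) k) = rat_of_int (int (n choose k) * fact k)"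
    using pochhammer_uminus_gbinomial[of k "of_nat n :: rat"]
    by (simp add: binomial_gbinomial flip: pochhammer_of_int)
  then show ?thesis by (simp only: of_int_eq_iff)
qed

text \<open>
  Up to sign, a product of \<open>k\<close> consecutive integers is \<open>pochhammer (- n) k\<close> for some natural
  number \<open>n\<close>, hence a binomial coefficient times \<open>k!\<close>: if its last factor \<open>a + k - 1\<close> is
  nonnegative, reverse the product and take that factor as \<open>n\<close>; otherwise take \<open>n = - a\<close>.
\<close>

lemma fact_dvd_pochhammer_int: "fact k dvd pochhammer (a :: int) k"
proof (cases "0 \<le> a + int k - 1")
  case True
  then obtain n where n: "a + int k - 1 = int n" by (metis nonneg_int_cases)
  have "a = int n - of_nat k + 1" using n by simp
  then have "pochhammer a k = (-1) ^ k * pochhammer (- int n) k"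
    by (simp only: pochhammer_minus')
  then show ?thesis by (simp only: pochhammer_uminus_of_nat dvd_triv_right)
next
  case False
  show ?thesis
  proof (cases "k = 0")
    case False
    with \<open>\<not> 0 \<le> a + int k - 1\<close> have "a \<le> 0" by simp
    then obtain n where "a = - int n" by (metis nonpos_int_cases)
    then have "pochhammer a k = (-1) ^ k * ((-1) ^ k * pochhammer (- int n) k)"
      by (simp flip: mult.assoc power_mult_distrib)
    then show ?thesis by (simp only: pochhammer_uminus_of_nat dvd_mult dvd_triv_right)
  qed simp
qed

lemma dvd_binomial_times_fact:
  assumes "0 < i"
  shows "int h dvd int (h choose i) * fact i"
proof -
  have "h * ((h - 1) choose (i - 1)) * fact (i - 1) = i * (h choose i) * fact (i - 1)"
    by (simp only: times_binomial_minus1_eq[OF assms])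
  also have "\<dots> = (h choose i) * fact i"
    using assms by (simp add: fact_reduce)
  finally have "h dvd (h choose i) * fact i" by (metis dvd_triv_left mult.assoc)
  then have "int h dvd int ((h choose i) * fact i)" by (simp only: of_nat_dvd_iff)
  then show ?thesis by simp
qed

lemma sum_cong_first_term:
  fixes f :: "nat \<Rightarrow> int"
  assumes "\<And>i. 0 < i \<Longrightarrow> i \<le> m \<Longrightarrow> k dvd f i"
  shows "[f 0 = (\<Sum>i=0..m. f i)] (mod k)"
proof -
  have "k dvd (\<Sum>i=Suc 0..m. f i)" by (rule dvd_sum) (use assms in auto)
  then show ?thesis by (simp add: sum.atLeast_Suc_atMost cong_iff_dvd_diff)
qed

section \<open>The parameters 1 and -1\<close>

theorem C_seq_1_1:
  "(C_seq h m 1 1 :: int) =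
     (\<Sum>i=0..m. of_nat (h choose i) * pochhammer (- int h) i * fact (m - i))"
proof -
  have "(-1) ^ i * ((-1) ^ i * x) = x" for i and x :: int
    by (simp flip: mult.assoc power_mult_distrib)
  then show ?thesis
    unfolding C_seq_eq_sum gen_fact_prod_1 gen_fact_prod_minus_1
    by (simp add: pochhammer_fact mult.assoc)
qed

theorem C_seq_minus_1:
  "(C_seq h m (- 1) R :: int) =
     (\<Sum>i=0..m. of_nat (h choose i) * pochhammer (R + 1 - int h) i * (-1) ^ m *
        pochhammer (- R) (m - i))"
  unfolding C_seq_eq_sum
proof (rule sum.cong[OF refl])
  fix i assume "i \<in> {0..m}"
  then have "(-1) ^ m = (-1) ^ i * ((-1) ^ (m - i) :: int)" by (simp flip: power_add)
  moreover have "R + (of_nat h - 1) * - 1 = R + 1 - int h" by simp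
  ultimately show "of_nat (h choose i) * (-1) ^ i *
      gen_fact_prod i (- (- 1)) (R + (of_nat h - 1) * - 1) * gen_fact_prod (m - i) (- 1) R =
      of_nat (h choose i) * pochhammer (R + 1 - int h) i * (-1) ^ m * pochhammer (- R) (m - i)"
    unfolding minus_minus gen_fact_prod_1 gen_fact_prod_minus_1 by (simp only: mult_ac)
qed

section \<open>The congruences\<close>

theorem lemma10:
  fixes h n m :: nat and s :: int
  assumes "h \<ge> 2" and "int m = int n - s"
  shows "[fact m = (C_seq h m 1 1 :: int)] (mod (int h))
    \<and> (C_seq h m 1 1 :: int) = (\<Sum>i=0..m. of_nat (h choose i) * pochhammer (- int h) i * fact (m - i))
    \<and> (C_seq h m 1 1 :: int) = (\<Sum>i=0..m. of_nat (h choose i) ^ 2 * (-1) ^ i * fact i * fact (m - i))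
    \<and> rat_of_int (C_seq h m 1 1) = (\<Sum>i=0..m. of_nat (h choose i)
           * (rat_of_int (int i - int h - 1) gchoose i) * fact i * fact (m - i))
    \<and> [fact m = (C_seq h m (-1) (int n - s) :: int)] (mod (int h))
    \<and> (C_seq h m (-1) (int n - s) :: int) = (\<Sum>i=0..m. of_nat (h choose i)
           * pochhammer (int n + 1 - s - int h) i * (-1) ^ m
           * pochhammer (- (int n - s)) (m - i))
    \<and> rat_of_int (C_seq h m (-1) (int n - s)) = (\<Sum>i=0..m. of_nat (h choose i) * of_nat (m choose i)
           * (rat_of_int (int h - int n + s - 1) gchoose i) * fact i * fact (m - i))
    \<and> [(C_seq h m (-1) (int n - s) :: int) = (\<Sum>i=0..m. of_nat (h choose i)
           * pochhammer (int n + 1 - s - int h) i * (-1) ^ (m - i)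
           * pochhammer (- (int n - s)) (m - i))] (mod (int h))
    \<and> rat_of_int (\<Sum>i=0..m. of_nat (h choose i)
           * pochhammer (int n + 1 - s - int h) i * (-1) ^ (m - i)
           * pochhammer (- (int n - s)) (m - i))
         = (\<Sum>i=0..m. of_nat (h choose i) * of_nat (m choose i)
           * (rat_of_int (int h - int n + s - 1) gchoose i) * (-1) ^ i * fact i * fact (m - i))"
proof -
  define P where "P i = pochhammer (int m + 1 - int h) i" for i
  have r: "int n - s = int m" "int n + 1 - s - int h = int m + 1 - int h"
      "rat_of_int (int h - int n + s - 1) = - rat_of_int (int m + 1 - int h)"
    using assms(2) by simp_all

  have first_sq: "int (h choose i) * pochhammer (- int h) i =
      int (h choose i) ^ 2 * (-1) ^ i * fact i" for i
  proof -
    have "int (h choose i) * pochhammer (- int h) i =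
        int (h choose i) * (-1) ^ i * ((-1) ^ i * pochhammer (- int h) i)"
      by (simp flip: mult.assoc power_mult_distrib)
    also have "\<dots> = int (h choose i) * (-1) ^ i * (int (h choose i) * fact i)"
      by (simp only: pochhammer_uminus_of_nat)
    finally show ?thesis by (simp add: power2_eq_square mult_ac)
  qed
  have first_gbinomial: "rat_of_int (pochhammer (- int h) i) =
      (rat_of_int (int i - int h - 1) gchoose i) * fact i" for i
    by (simp add: gbinomial_pochhammer' pochhammer_of_int[symmetric])
  have first_cong: "[fact m = (C_seq h m 1 1 :: int)] (mod int h)"
  proof -
    \<comment> \<open>The first factor of \<open>pochhammer (- int h) i\<close> is \<open>- int h\<close>.\<close>
    have "int h dvd int (h choose i) * pochhammer (- int h) i * fact (m - i)" if "0 < i" for i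
      using that by (cases i) (simp_all add: pochhammer_rec dvd_mult dvd_mult2)
    from sum_cong_first_term[of m "int h"
        "\<lambda>i. int (h choose i) * pochhammer (- int h) i * fact (m - i)", OF this]
    show ?thesis by (simp add: C_seq_1_1)
  qed

  \<comment> \<open>\<open>T i\<close> is the \<open>i\<close>-th term of the second sum without its sign \<open>(-1) ^ i\<close>. Its last factor
    is the falling product \<open>m * (m - 1) * \<dots> * (i + 1)\<close>, in a form that avoids division.\<close>
  define T where "T i = int (h choose i) * P i * (int (m choose i) * fact (m - i))" for i
  have fall: "(-1) ^ (m - i) * pochhammer (- int m) (m - i) = int (m choose i) * fact (m - i)"
    if "i \<le> m" for i
    using pochhammer_uminus_of_nat[of "m - i" m] binomial_symmetric[OF that] by simp
  have T1: "int (h choose i) * P i * (-1) ^ (m - i) * pochhammer (- int m) (m - i) = T i"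
    if "i \<le> m" for i
    unfolding T_def fall[OF that, symmetric] by (simp only: mult_ac)
  have T2: "int (h choose i) * P i * (-1) ^ m * pochhammer (- int m) (m - i) = (-1) ^ i * T i"
    if "i \<le> m" for i
  proof -
    have "(-1) ^ m = (-1) ^ i * ((-1) ^ (m - i) :: int)" using that by (simp flip: power_add)
    then show ?thesis unfolding T1[OF that, symmetric] by (simp only: mult_ac)
  qed
  have second: "C_seq h m (- 1) (int m) = (\<Sum>i=0..m. (-1) ^ i * T i)"
    unfolding C_seq_minus_1 P_def[symmetric] by (rule sum.cong) (simp_all add: T2)
  have unsigned: "(\<Sum>i=0..m. int (h choose i) * P i * (-1) ^ (m - i)
      * pochhammer (- int m) (m - i)) = (\<Sum>i=0..m. T i)"
    by (rule sum.cong) (simp_all add: T1)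
  have gb: "(- rat_of_int (int m + 1 - int h) gchoose i) * fact i = (-1) ^ i * rat_of_int (P i)"
    for i
    unfolding P_def pochhammer_uminus_gbinomial[symmetric] minus_minus pochhammer_of_int ..
  have T_gbinomial: "of_nat (h choose i) * of_nat (m choose i)
      * (- rat_of_int (int m + 1 - int h) gchoose i) * fact i * fact (m - i)
      = rat_of_int ((-1) ^ i * T i)" for i
  proof -
    have "of_nat (h choose i) * of_nat (m choose i)
      * (- rat_of_int (int m + 1 - int h) gchoose i) * fact i * fact (m - i)
      = of_nat (h choose i) * of_nat (m choose i) * fact (m - i)
        * ((- rat_of_int (int m + 1 - int h) gchoose i) * fact i)" by (simp only: mult_ac)
    then show ?thesis unfolding gb by (simp add: T_def mult_ac)
  qed
  have T_gbinomial': "of_nat (h choose i) * of_nat (m choose i)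
      * (- rat_of_int (int m + 1 - int h) gchoose i) * (-1) ^ i * fact i * fact (m - i)
      = rat_of_int (T i)" for i
  proof -
    have "of_nat (h choose i) * of_nat (m choose i)
      * (- rat_of_int (int m + 1 - int h) gchoose i) * (-1) ^ i * fact i * fact (m - i)
      = (-1) ^ i * rat_of_int ((-1) ^ i * T i)"
      unfolding T_gbinomial[symmetric] by (simp only: mult_ac)
    then show ?thesis by (simp flip: mult.assoc power_mult_distrib)
  qed
  have dvd_T: "int h dvd T i" if "0 < i" for i
  proof -
    obtain t where "P i = fact i * t"
      unfolding P_def using fact_dvd_pochhammer_int by (metis dvdE)
    then have "T i = int (h choose i) * fact i * (t * (int (m choose i) * fact (m - i)))"
      by (simp add: T_def mult_ac)
    then show ?thesis using dvd_binomial_times_fact[OF that] by simp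
  qed
  have T0: "T 0 = fact m" by (simp add: T_def P_def)
  have cong2: "[fact m = C_seq h m (- 1) (int m)] (mod int h)"
    using sum_cong_first_term[of m "int h" "\<lambda>i. (-1) ^ i * T i"] dvd_T
    by (simp add: second T0)
  have cong3: "[fact m = (\<Sum>i=0..m. T i)] (mod int h)"
    using sum_cong_first_term[of m "int h" T] dvd_T by (simp add: T0)

  show ?thesis
    unfolding r P_def[symmetric] unsigned
  proof (intro conjI)
    show "(C_seq h m 1 1 :: int) =
        (\<Sum>i=0..m. of_nat (h choose i) ^ 2 * (-1) ^ i * fact i * fact (m - i))"
      unfolding C_seq_1_1 by (simp only: first_sq)
    show "rat_of_int (C_seq h m 1 1) = (\<Sum>i=0..m. of_nat (h choose i)
           * (rat_of_int (int i - int h - 1) gchoose i) * fact i * fact (m - i))"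
      unfolding C_seq_1_1 of_int_sum of_int_mult first_gbinomial by (simp add: mult.assoc)
    show "C_seq h m (- 1) (int m) = (\<Sum>i=0..m. of_nat (h choose i) * P i * (-1) ^ m
           * pochhammer (- int m) (m - i))"
      by (simp only: C_seq_minus_1 P_def)
    show "rat_of_int (C_seq h m (- 1) (int m)) =
        (\<Sum>i=0..m. of_nat (h choose i) * of_nat (m choose i)
           * (- rat_of_int (int m + 1 - int h) gchoose i) * fact i * fact (m - i))"
      by (simp only: second T_gbinomial of_int_sum)
    show "rat_of_int (\<Sum>i=0..m. T i) =
        (\<Sum>i=0..m. of_nat (h choose i) * of_nat (m choose i)
           * (- rat_of_int (int m + 1 - int h) gchoose i) * (-1) ^ i * fact i * fact (m - i))"
      by (simp only: T_gbinomial' of_int_sum)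
    show "[C_seq h m (- 1) (int m) = (\<Sum>i=0..m. T i)] (mod int h)"
      using cong2 cong3 by (metis cong_sym cong_trans)
  qed (use first_cong cong2 C_seq_1_1 in simp_all)
qed

end
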